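(* Let $n \ge 1$ and $k \ge 3$ be positive integers. Pick $k$ distinct sticks, each of which has length chosen, independently of the others, from the uniform distribution on $\{1,2,\ldots,n\}$. The probability that the resulting $k$ sticks form a $k$-gon is $$1 - \frac{k\binom{n+1}{k}}{n^k}.$$
   Context: The sticks are distinct as objects, but their lengths are allowed to coincide: the sample space is the set $\{1,\ldots,n\}^k$ of vectors $(x_1,\ldots,x_k)$ of stick lengths, all $n^k$ vectors being equally likely. The $k$ sticks "form a $k$-gon" if there exists a (convex) nondegenerate planar polygon (i.e., with nonempty interior) with $k$ sides whose multiset of side lengths is $\{x_1,\ldots,x_k\}$. The sides may be arranged in any order. The convention $\binom{m}{j} = 0$ for integers $0 \le m < j$ is used. *)

theory Defs
  imports "HOL-Probability.Probability"
begin

text \<open>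
  A nondegenerate convex polygon is a polytope in the plane with nonempty interior. Its sides are
  its one-dimensional faces, so consecutive sides are never collinear. Each side is a closed
  segment, whose length is its diameter.
\<close>

definition convex_polygon :: "(real ^ 2) set \<Rightarrow> bool" where
  "convex_polygon P \<longleftrightarrow> polytope P \<and> interior P \<noteq> {}"

definition sides :: "(real ^ 2) set \<Rightarrow> (real ^ 2) set set" where
  "sides P = {e. e edge_of P}"

definition side_lengths :: "(real ^ 2) set \<Rightarrow> real multiset" where
  "side_lengths P = image_mset diameter (mset_set (sides P))"

definition forms_polygon :: "nat \<Rightarrow> (nat \<Rightarrow> nat) \<Rightarrow> bool" where
  "forms_polygon k x \<longleftrightarrow>
     (\<exists>P. convex_polygon P \<and> card (sides P) = k \<and>
          side_lengths P = image_mset (\<lambda>i. real (x i)) (mset_set {1..k}))"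

definition stick_lengths :: "nat \<Rightarrow> nat \<Rightarrow> (nat \<Rightarrow> nat) set" where
  "stick_lengths n k = {1..k} \<rightarrow>\<^sub>E {1..n}"

end

theory Submission
  imports Defs
begin

text \<open>
  The sticks form a polygon if and only if each stick is shorter than all the others together
  (\<open>forms_polygon_iff\<close>). After that the theorem is a count: call a stick dominant if it is at least as
  long as all the others together. For \<open>k \<ge> 3\<close> at most one stick is dominant, since the third stick has
  positive length. A dominant stick of length \<open>m\<close> leaves a vector of \<open>k - 1\<close> positive integers of sum
  at most \<open>m\<close>, and there are \<open>m choose (k - 1)\<close> of those; summing over \<open>m \<le> n\<close> gives
  \<open>(n + 1) choose k\<close> vectors for each of the \<open>k\<close> possible positions of the dominant stick.

  The inequality is necessary (\<open>side_shorter_than_others\<close>) because the polygon lies on one side of the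
  line through a side \<open>e\<close>: seen along the normal of that line, every inner point of \<open>e\<close> hides a boundary
  point on another side, so the orthogonal projections of the other sides cover \<open>e\<close>. Projecting does not
  lengthen a segment, and it shortens at least one of them strictly, because the sides of a polygon
  cannot all be parallel. Measuring the cover avoids putting the sides of an abstract polytope into
  cyclic order.

  The inequality is sufficient because the sticks can then be inscribed as chords in a circle: an
  intermediate value argument for the radius (\<open>sticks_as_chords\<close>) yields half central angles with sum
  \<open>\<pi>\<close>, and the partial sums of these are the positions of the vertices (\<open>inscribed_polygon\<close>). That the
  edges of the convex hull are exactly the chords between consecutive vertices (\<open>sides_hull\<close>) depends on
  nothing but the signs of the orientation determinants of triples of vertices.
\<close>

section \<open>A side is shorter than the other sides together\<close>

lemma inner_real2: "x \<bullet> y = x $ 1 * y $ 1 + x $ 2 * y $ 2" for x y :: "real ^ 2"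
  by (simp add: inner_vec_def sum_2)

lemma norm_real2_sq: "(norm x)\<^sup>2 = (x $ 1)\<^sup>2 + (x $ 2)\<^sup>2" for x :: "real ^ 2"
  unfolding power2_norm_eq_inner inner_real2 by (simp add: power2_eq_square)

lemma diameter_closed_segment: "diameter (closed_segment a b) = dist a b"
  for a b :: "'a::euclidean_space"
proof (rule antisym)
  show "diameter (closed_segment a b) \<le> dist a b"
  proof (rule diameter_le)
    fix x y assume "x \<in> closed_segment a b" "y \<in> closed_segment a b"
    then obtain r t where r: "x = (1 - r) *\<^sub>R a + r *\<^sub>R b" "0 \<le> r" "r \<le> 1"
      and t: "y = (1 - t) *\<^sub>R a + t *\<^sub>R b" "0 \<le> t" "t \<le> 1"
      by (auto simp: in_segment)
    have "x - y = (t - r) *\<^sub>R (a - b)" unfolding r(1) t(1) by (simp add: algebra_simps)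
    then have "norm (x - y) = \<bar>t - r\<bar> * dist a b" by (simp add: dist_norm)
    also have "\<dots> \<le> 1 * dist a b" using r t by (intro mult_right_mono) auto
    finally show "norm (x - y) \<le> dist a b" by simp
  qed simp
  show "dist a b \<le> diameter (closed_segment a b)"
    by (rule diameter_bounded_bound) (auto intro: compact_imp_bounded)
qed

text \<open>
  In the plane edges and facets are the same faces. This brings in the decomposition of the frontier
  of a polyhedron into its facets.
\<close>

lemma sides_are_facets:
  assumes "convex_polygon P"
  shows "e \<in> sides P \<longleftrightarrow> e facet_of P"
proof -
  have "aff_dim P = 2"
    using assms aff_dim_nonempty_interior[of P] by (simp add: convex_polygon_def)
  then show ?thesis
    by (auto simp: sides_def edge_of_def facet_of_def)
qed

lemma finite_sides: "convex_polygon P \<Longrightarrow> finite (sides P)"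
  unfolding convex_polygon_def sides_def edge_of_def
  by (rule finite_subset[OF _ finite_polytope_faces[of P]]) auto

lemma frontier_polygon:
  assumes "convex_polygon P"
  shows "frontier P = \<Union> (sides P)"
  using assms rel_frontier_of_polyhedron[OF polytope_imp_polyhedron, of P]
    rel_frontier_nonempty_interior[of P] sides_are_facets[OF assms]
  by (auto simp: convex_polygon_def)

lemma side_is_segment:
  assumes "convex_polygon P" "e \<in> sides P"
  obtains a b where "e = closed_segment a b" "a \<noteq> b"
proof -
  have e: "e face_of P" "aff_dim e = 1" using assms(2) by (auto simp: sides_def edge_of_def)
  have "polytope e" using assms(1) e(1) face_of_polytope_polytope by (auto simp: convex_polygon_def)
  moreover have "e \<noteq> {}" "collinear e" using e(2) by (auto simp: collinear_aff_dim)
  ultimately obtain a b where "e = closed_segment a b"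
    using compact_convex_collinear_segment polytope_imp_compact polytope_imp_convex by metis
  then show thesis using that e(2) by (cases "a = b") auto
qed

lemma side_supporting_line:
  assumes "convex_polygon P" "e \<in> sides P"
  obtains w c where "w \<noteq> 0" "P \<subseteq> {x. w \<bullet> x \<le> c}" "e = P \<inter> {x. w \<bullet> x = c}"
proof -
  have e: "e face_of P" "aff_dim e = 1" using assms(2) by (auto simp: sides_def edge_of_def)
  have P: "aff_dim P = 2"
    using assms(1) aff_dim_nonempty_interior[of P] by (simp add: convex_polygon_def)
  have "e exposed_face_of P"
    using assms(1) e(1) exposed_face_of_polyhedron[OF polytope_imp_polyhedron]
    by (auto simp: convex_polygon_def)
  moreover have "e \<noteq> {}" "e \<noteq> P" using e(2) P by auto
  ultimately show thesis using that by (auto simp: exposed_face_of)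
qed

text \<open>
  Starting from a point of a compact set and moving against \<open>w\<close> leads to a frontier point, and the
  coordinate along a direction \<open>u\<close> orthogonal to \<open>w\<close> does not change on the way. A lowest point of the
  slice has to be on the frontier: from an interior point one could move further down.
\<close>

lemma drop_to_frontier:
  fixes P :: "'a::euclidean_space set"
  assumes "compact P" "p \<in> P" "u \<bullet> w = 0" "w \<noteq> 0"
  obtains y where "y \<in> frontier P" "u \<bullet> y = u \<bullet> p" "w \<bullet> y \<le> w \<bullet> p"
proof -
  let ?K = "P \<inter> {x. u \<bullet> x = u \<bullet> p}"
  have "compact ?K" using assms(1) by (intro compact_Int_closed closed_hyperplane)
  moreover have "?K \<noteq> {}" using assms(2) by auto
  moreover have "continuous_on ?K ((\<bullet>) w)" by (intro continuous_intros)
  ultimately have "\<exists>y\<in>?K. \<forall>x\<in>?K. w \<bullet> y \<le> w \<bullet> x" by (rule continuous_attains_inf)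
  then obtain y where y: "y \<in> ?K" "\<And>x. x \<in> ?K \<Longrightarrow> w \<bullet> y \<le> w \<bullet> x" by blast
  have "y \<notin> interior P"
  proof
    assume "y \<in> interior P"
    then obtain d where d: "d > 0" "cball y d \<subseteq> P" unfolding mem_interior_cball by blast
    let ?z = "y - (d / norm w) *\<^sub>R w"
    have "dist y ?z \<le> d" using d assms(4) by (simp add: dist_norm)
    then have "?z \<in> ?K"
      using d y(1) assms(3) by (auto simp: inner_diff_right)
    from y(2)[OF this] have "(d / norm w) * (w \<bullet> w) \<le> 0" by (simp add: inner_diff_right)
    moreover have "(d / norm w) * (w \<bullet> w) > 0" using d assms(4) by simp
    ultimately show False by simp
  qed
  moreover have "y \<in> closure P" using y(1) closure_subset by auto
  ultimately show thesis using that y(1) y(2)[of p] assms(2) by (auto simp: frontier_def)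
qed

lemma inner_image_segment: "(\<bullet>) u ` closed_segment a b = closed_segment (u \<bullet> a) (u \<bullet> b)"
  by (rule closed_segment_linear_image[symmetric])
    (simp add: bounded_linear.linear bounded_linear_inner_right)

lemma measure_projected_segment:
  fixes u :: "'a::euclidean_space"
  shows "measure lborel ((\<bullet>) u ` closed_segment a b) = \<bar>u \<bullet> (b - a)\<bar>"
    and "(\<bullet>) u ` closed_segment a b \<in> sets borel"
proof -
  have eq: "(\<bullet>) u ` closed_segment a b = {min (u \<bullet> a) (u \<bullet> b)..max (u \<bullet> a) (u \<bullet> b)}"
    by (simp add: inner_image_segment closed_segment_eq_real_ivl min_def max_def)
  show "measure lborel ((\<bullet>) u ` closed_segment a b) = \<bar>u \<bullet> (b - a)\<bar>"
    unfolding eq by (simp add: inner_diff_right min_def max_def)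
  show "(\<bullet>) u ` closed_segment a b \<in> sets borel" unfolding eq by simp
qed

text \<open>
  With \<open>u\<close> the vector along the side \<open>e\<close>, the map \<open>x \<mapsto> u \<bullet> x\<close> is the orthogonal projection to the line of
  \<open>e\<close>, scaled by \<open>norm u\<close>. The image of \<open>e\<close> has length \<open>(norm u)\<^sup>2\<close> and is covered, up to its end points,
  by the images of the other sides, which are at most \<open>norm u\<close> times as long as these sides.
\<close>

lemma side_shorter_than_others:
  assumes P: "convex_polygon P" and e: "e \<in> sides P"
  shows "diameter e < (\<Sum>s\<in>sides P - {e}. diameter s)"
proof -
  obtain a b where ab: "e = closed_segment a b" "a \<noteq> b" using side_is_segment[OF P e] .
  obtain w c where w: "w \<noteq> 0" "P \<subseteq> {x. w \<bullet> x \<le> c}" "e = P \<inter> {x. w \<bullet> x = c}"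
    using side_supporting_line[OF P e] .
  define u where "u = b - a"
  have u0: "u \<noteq> 0" using ab by (simp add: u_def)
  have compP: "compact P" and convP: "convex P" and intP: "interior P \<noteq> {}"
    using P polytope_imp_compact polytope_imp_convex by (auto simp: convex_polygon_def)
  have aP: "a \<in> P" "b \<in> P" "w \<bullet> a = c" "w \<bullet> b = c" using ab w(3) by auto
  have uw: "u \<bullet> w = 0" using aP by (simp add: u_def inner_commute inner_diff_right)
  obtain q where qi: "q \<in> interior P" using intP by auto
  then have q: "q \<in> P" using interior_subset by auto
  have "w \<bullet> q < c"
  proof -
    have "interior P \<subseteq> interior {x. w \<bullet> x \<le> c}" using w(2) by (rule interior_mono)
    then show ?thesis using qi w(1) by auto
  qed
  have cover: "{u \<bullet> a<..<u \<bullet> b} \<subseteq> (\<Union>s\<in>sides P - {e}. (\<bullet>) u ` s)"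
  proof
    fix t assume t: "t \<in> {u \<bullet> a<..<u \<bullet> b}"
    \<comment> \<open>The point \<open>(1 - r) *\<^sub>R q + r *\<^sub>R z\<close> with z on e lies in the polygon strictly off e. It projects
      to t if z projects to \<open>?g r\<close>, and for r close to 1 this value is close to t, so z exists.\<close>
    let ?g = "\<lambda>r. (t - (1 - r) * (u \<bullet> q)) / r"
    have "(?g \<longlongrightarrow> (t - (1 - 1) * (u \<bullet> q)) / 1) (at_left (1::real))"
      by (intro tendsto_intros) auto
    then have "(?g \<longlongrightarrow> t) (at_left 1)" by simp
    then have "eventually (\<lambda>r. ?g r \<in> {u \<bullet> a<..<u \<bullet> b}) (at_left 1)"
      using t by (rule topological_tendstoD[OF _ open_greaterThanLessThan])
    moreover have "eventually (\<lambda>r::real. r \<in> {0<..<1}) (at_left 1)"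
      by (rule eventually_at_leftI[of 0]) auto
    ultimately have "eventually (\<lambda>r. ?g r \<in> {u \<bullet> a<..<u \<bullet> b} \<and> r \<in> {0<..<1}) (at_left 1)"
      by (rule eventually_conj)
    then obtain r where r: "?g r \<in> {u \<bullet> a<..<u \<bullet> b}" "r \<in> {0<..<1}"
      using eventually_happens by (metis (no_types, lifting) trivial_limit_at_left_real)
    have "?g r \<in> (\<bullet>) u ` closed_segment a b"
      using r(1) unfolding inner_image_segment closed_segment_eq_real_ivl by auto
    then obtain z where z: "z \<in> e" "u \<bullet> z = ?g r" using ab(1) by auto
    let ?p = "(1 - r) *\<^sub>R q + r *\<^sub>R z"
    have zP: "z \<in> P" "w \<bullet> z = c" using z(1) w(3) by auto
    have p: "?p \<in> P" using convP q zP(1) r(2) by (intro convexD) auto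
    have up: "u \<bullet> ?p = t" using z(2) r(2) by (simp add: inner_add_right)
    have "(1 - r) * (w \<bullet> q) < (1 - r) * c" using \<open>w \<bullet> q < c\<close> r(2) by simp
    then have wp: "w \<bullet> ?p < c" using zP(2) by (simp add: inner_add_right algebra_simps)
    obtain y where y': "y \<in> frontier P" "u \<bullet> y = u \<bullet> ?p" "w \<bullet> y \<le> w \<bullet> ?p"
      using drop_to_frontier[OF compP p uw w(1)] .
    then have y: "y \<in> frontier P" "u \<bullet> y = t" "w \<bullet> y < c"
      unfolding up using wp by simp_all
    then obtain s where "s \<in> sides P" "y \<in> s" using frontier_polygon[OF P] by auto
    moreover have "s \<noteq> e" using \<open>y \<in> s\<close> y(3) w(3) by auto
    ultimately show "t \<in> (\<Union>s\<in>sides P - {e}. (\<bullet>) u ` s)" using y(2) by auto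
  qed
  have seg: "\<exists>x y. s = closed_segment x y" if "s \<in> sides P" for s
    using side_is_segment[OF P that] by metis
  have fin: "finite (sides P)" by (rule finite_sides[OF P])
  have len: "measure lborel ((\<bullet>) u ` s) \<le> norm u * diameter s"
    and meas: "(\<bullet>) u ` s \<in> sets borel" if s: "s \<in> sides P" for s
  proof -
    obtain x y where xy: "s = closed_segment x y" using seg[OF s] by auto
    show "measure lborel ((\<bullet>) u ` s) \<le> norm u * diameter s"
      unfolding xy measure_projected_segment diameter_closed_segment dist_norm
      using Cauchy_Schwarz_ineq2[of u "y - x"] by (simp add: norm_minus_commute)
    show "(\<bullet>) u ` s \<in> sets borel" unfolding xy by (rule measure_projected_segment)
  qed
  \<comment> \<open>If all sides were parallel to e, then w would be constant on each of them and take only finitely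
    many values on the frontier. But each value between those at q and at e occurs on the frontier:
    slide a point of the polygon along u until it gets there.\<close>
  have "\<exists>s\<in>sides P. \<exists>x y. s = closed_segment x y \<and> w \<bullet> (y - x) \<noteq> 0"
  proof (rule ccontr)
    assume contr: "\<not> ?thesis"
    have "finite ((\<bullet>) w ` s)" if s: "s \<in> sides P" for s
    proof -
      obtain x y where xy: "s = closed_segment x y" using seg[OF s] by auto
      then have "w \<bullet> x = w \<bullet> y" using contr s by (auto simp: inner_diff_right)
      then show ?thesis unfolding xy inner_image_segment by simp
    qed
    then have "finite (\<Union>s\<in>sides P. (\<bullet>) w ` s)" using fin by blast
    moreover have "{w \<bullet> q<..<c} \<subseteq> (\<Union>s\<in>sides P. (\<bullet>) w ` s)"
    proof
      fix t assume t: "t \<in> {w \<bullet> q<..<c}"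
      have "t \<in> (\<bullet>) w ` closed_segment q a"
        using t aP(3) unfolding inner_image_segment closed_segment_eq_real_ivl by auto
      then obtain p where p: "p \<in> P" "w \<bullet> p = t"
        using closed_segment_subset[OF q aP(1) convP] by auto
      obtain y where "y \<in> frontier P" "w \<bullet> y = t"
        using drop_to_frontier[OF compP p(1), of w u] uw u0 p(2) by (auto simp: inner_commute)
      then show "t \<in> (\<Union>s\<in>sides P. (\<bullet>) w ` s)" using frontier_polygon[OF P] by auto
    qed
    ultimately have "finite {w \<bullet> q<..<c}" by (rule rev_finite_subset)
    then show False using \<open>w \<bullet> q < c\<close> by (simp add: infinite_Ioo)
  qed
  then obtain s x y where s: "s \<in> sides P" "s = closed_segment x y" "w \<bullet> (y - x) \<noteq> 0" by auto
  have "s \<noteq> e"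
  proof
    assume "s = e"
    then have "w \<bullet> x = c" "w \<bullet> y = c" using s(2) w(3) by auto
    then show False using s(3) by (simp add: inner_diff_right)
  qed
  have strict: "measure lborel ((\<bullet>) u ` s) < norm u * diameter s"
  proof -
    \<comment> \<open>Equality in the Cauchy-Schwarz inequality would make the side s parallel to u.\<close>
    have "\<bar>u \<bullet> (y - x)\<bar> \<noteq> norm u * norm (y - x)"
    proof
      assume "\<bar>u \<bullet> (y - x)\<bar> = norm u * norm (y - x)"
      then have "norm u *\<^sub>R (y - x) = norm (y - x) *\<^sub>R u \<or>
                 norm u *\<^sub>R (y - x) = - norm (y - x) *\<^sub>R u"
        by (simp only: norm_cauchy_schwarz_abs_eq)
      then obtain r where "norm u *\<^sub>R (y - x) = r *\<^sub>R u" by blast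
      then have "w \<bullet> (norm u *\<^sub>R (y - x)) = w \<bullet> (r *\<^sub>R u)" by (rule arg_cong)
      then have "norm u * (w \<bullet> (y - x)) = 0"
        using uw by (simp add: inner_commute[of w u] del: inner_diff_right)
      then show False using u0 s(3) by simp
    qed
    then show ?thesis
      unfolding s(2) measure_projected_segment diameter_closed_segment dist_norm
      using Cauchy_Schwarz_ineq2[of u "y - x"] by (simp add: norm_minus_commute)
  qed
  have "norm u * norm u = measure lborel {u \<bullet> a<..<u \<bullet> b}"
  proof -
    have "u \<bullet> b - u \<bullet> a = norm u * norm u"
      by (simp add: u_def flip: inner_diff_right power2_norm_eq_inner power2_eq_square)
    moreover from this have "u \<bullet> a \<le> u \<bullet> b" by (metis diff_ge_0_iff_ge zero_le_square)
    ultimately show ?thesis by simp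
  qed
  also have "\<dots> \<le> measure lborel (\<Union>s\<in>sides P - {e}. (\<bullet>) u ` s)"
  proof (rule measure_mono_fmeasurable[OF cover])
    show "(\<Union>s\<in>sides P - {e}. (\<bullet>) u ` s) \<in> fmeasurable lborel"
    proof (rule fmeasurable.finite_UN)
      show "(\<bullet>) u ` s \<in> fmeasurable lborel" if s: "s \<in> sides P - {e}" for s
      proof -
        obtain x y where "s = closed_segment x y" using seg[of s] s by blast
        then have "compact ((\<bullet>) u ` s)"
          by (auto intro!: compact_continuous_image continuous_intros)
        then show ?thesis by (rule fmeasurable_compact)
      qed
    qed (use fin in simp)
  qed simp
  also have "\<dots> \<le> (\<Sum>s\<in>sides P - {e}. measure lborel ((\<bullet>) u ` s))"
    using fin meas by (intro measure_UNION_le) auto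
  also have "\<dots> < (\<Sum>s\<in>sides P - {e}. norm u * diameter s)"
    using fin len strict s(1) \<open>s \<noteq> e\<close> by (intro sum_strict_mono_ex1) auto
  also have "\<dots> = norm u * (\<Sum>s\<in>sides P - {e}. diameter s)"
    by (simp add: sum_distrib_left)
  finally have "norm u < (\<Sum>s\<in>sides P - {e}. diameter s)"
    using u0 by simp
  then show ?thesis
    unfolding ab(1) diameter_closed_segment u_def dist_norm by (simp add: norm_minus_commute)
qed

lemma forms_polygonD:
  assumes "forms_polygon k x" "i \<in> {1..k}"
  shows "x i < sum x ({1..k} - {i})"
proof -
  obtain P where P: "convex_polygon P"
    and eq: "side_lengths P = image_mset (\<lambda>i. real (x i)) (mset_set {1..k})"
    using assms(1) by (auto simp: forms_polygon_def)
  have fin: "finite (sides P)" by (rule finite_sides[OF P])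
  have "real (x i) \<in># side_lengths P" using assms(2) unfolding eq by auto
  then obtain e where e: "e \<in> sides P" "diameter e = real (x i)"
    using fin by (auto simp: side_lengths_def)
  have "(\<Sum>s\<in>sides P. diameter s) = (\<Sum>j\<in>{1..k}. real (x j))"
    using arg_cong[OF eq, of sum_mset] by (simp add: side_lengths_def sum_unfold_sum_mset)
  moreover have "(\<Sum>s\<in>sides P. diameter s) = diameter e + (\<Sum>s\<in>sides P - {e}. diameter s)"
    by (rule sum.remove[OF fin e(1)])
  moreover have "(\<Sum>j\<in>{1..k}. real (x j)) = real (x i) + (\<Sum>j\<in>{1..k} - {i}. real (x j))"
    using assms(2) by (intro sum.remove) auto
  ultimately have "real (x i) < real (sum x ({1..k} - {i}))"
    using side_shorter_than_others[OF P e(1)] e(2) by simp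
  then show ?thesis by (simp only: of_nat_less_iff)
qed

section \<open>The hull of points in convex position\<close>

text \<open>
  Twice the signed area of the triangle with vertices \<open>a\<close>, \<open>b\<close>, \<open>c\<close>: positive if \<open>c\<close> lies to the left of
  the directed line from \<open>a\<close> to \<open>b\<close>.
\<close>

definition orient :: "real ^ 2 \<Rightarrow> real ^ 2 \<Rightarrow> real ^ 2 \<Rightarrow> real" where
  "orient a b c = (b $ 1 - a $ 1) * (c $ 2 - a $ 2) - (b $ 2 - a $ 2) * (c $ 1 - a $ 1)"

lemma orient_rotate: "orient a b c = orient b c a"
  by (simp add: orient_def algebra_simps)

lemma orient_swap: "orient a b c = - orient a c b"
  by (simp add: orient_def algebra_simps)

lemma orient_repeated [simp]: "orient a a b = 0" "orient a b a = 0" "orient a b b = 0"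
  by (simp_all add: orient_def)

lemma orient_eq_inner: "orient a b c = vector [a $ 2 - b $ 2, b $ 1 - a $ 1] \<bullet> c
    - vector [a $ 2 - b $ 2, b $ 1 - a $ 1] \<bullet> a"
  by (simp add: orient_def inner_real2 algebra_simps)

text \<open>
  A line in the plane is determined by two of its points, so every affine functional that vanishes at
  \<open>p\<close> and \<open>q\<close> is a multiple of \<open>orient p q\<close>. Hence a supporting line through two vertices leaves no
  freedom, and signs of \<open>orient\<close> decide on which side the other vertices are.
\<close>

lemma hyperplane_through_two_points:
  assumes "w \<noteq> 0" "p \<noteq> q" "w \<bullet> p = c" "w \<bullet> q = c"
  obtains d where "d \<noteq> 0" "\<And>r. w \<bullet> r - c = d * orient p q r"
proof -
  define v where "v = q - p"
  have "v \<noteq> 0" using assms(2) by (simp add: v_def)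
  then have n: "(v $ 1)\<^sup>2 + (v $ 2)\<^sup>2 \<noteq> 0"
    by (metis norm_real2_sq norm_eq_zero power_eq_0_iff)
  have wv: "w $ 1 * v $ 1 + w $ 2 * v $ 2 = 0"
    using assms(3,4) by (simp add: v_def inner_real2 algebra_simps)
  define d where "d = (w $ 2 * v $ 1 - w $ 1 * v $ 2) / ((v $ 1)\<^sup>2 + (v $ 2)\<^sup>2)"
  have dN: "d * ((v $ 1)\<^sup>2 + (v $ 2)\<^sup>2) = w $ 2 * v $ 1 - w $ 1 * v $ 2"
    using n by (simp add: d_def)
  have "(w $ 1 + d * v $ 2) * ((v $ 1)\<^sup>2 + (v $ 2)\<^sup>2)
      = w $ 1 * ((v $ 1)\<^sup>2 + (v $ 2)\<^sup>2) + v $ 2 * (w $ 2 * v $ 1 - w $ 1 * v $ 2)"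
    unfolding dN[symmetric] by (simp add: algebra_simps)
  also have "\<dots> = v $ 1 * (w $ 1 * v $ 1 + w $ 2 * v $ 2)"
    by (simp add: algebra_simps power2_eq_square)
  finally have "w $ 1 + d * v $ 2 = 0" unfolding wv using n mult_eq_0_iff by force
  then have w1: "w $ 1 = - d * v $ 2" by simp
  have "(w $ 2 - d * v $ 1) * ((v $ 1)\<^sup>2 + (v $ 2)\<^sup>2)
      = w $ 2 * ((v $ 1)\<^sup>2 + (v $ 2)\<^sup>2) - v $ 1 * (w $ 2 * v $ 1 - w $ 1 * v $ 2)"
    unfolding dN[symmetric] by (simp add: algebra_simps)
  also have "\<dots> = v $ 2 * (w $ 1 * v $ 1 + w $ 2 * v $ 2)"
    by (simp add: algebra_simps power2_eq_square)
  finally have "w $ 2 - d * v $ 1 = 0" unfolding wv using n mult_eq_0_iff by force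
  then have w2: "w $ 2 = d * v $ 1" by simp
  show thesis
  proof
    show "d \<noteq> 0"
      using assms(1) w1 w2 by (auto simp: vec_eq_iff forall_2)
    show "w \<bullet> r - c = d * orient p q r" for r
    proof -
      have "w \<bullet> r - c = w $ 1 * (r $ 1 - p $ 1) + w $ 2 * (r $ 2 - p $ 2)"
        using assms(3) by (simp add: inner_real2 algebra_simps)
      also have "\<dots> = d * (v $ 1 * (r $ 2 - p $ 2) - v $ 2 * (r $ 1 - p $ 1))"
        unfolding w1 w2 by (simp add: algebra_simps)
      finally show ?thesis by (simp add: orient_def v_def)
    qed
  qed
qed

text \<open>
  The points \<open>p 0, \<dots>, p (k - 1)\<close> are the vertices of a strictly convex polygon, listed counterclockwise.
\<close>

definition convex_position :: "nat \<Rightarrow> (nat \<Rightarrow> real ^ 2) \<Rightarrow> bool" where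
  "convex_position k p \<longleftrightarrow> (\<forall>i j l. i < j \<longrightarrow> j < l \<longrightarrow> l < k \<longrightarrow> orient (p i) (p j) (p l) > 0)"

context
  fixes k :: nat and p :: "nat \<Rightarrow> real ^ 2"
  assumes pos: "convex_position k p" and k3: "k \<ge> 3"
begin

private abbreviation "after i \<equiv> Suc i mod k"

private lemma orientD: "i < j \<Longrightarrow> j < l \<Longrightarrow> l < k \<Longrightarrow> orient (p i) (p j) (p l) > 0"
  using pos by (simp add: convex_position_def)

lemma vertices_not_collinear:
  assumes "i < k" "j < k" "l < k" "i \<noteq> j" "j \<noteq> l" "i \<noteq> l"
  shows "orient (p i) (p j) (p l) \<noteq> 0"
proof -
  have *: "orient (p i) (p j) (p l) \<noteq> 0"
    if "i < l" "j < l" "i < k" "j < k" "l < k" "i \<noteq> j" for i j l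
  proof -
    have "orient (p i) (p j) (p l) = - orient (p j) (p i) (p l)"
      using orient_rotate[of "p i" "p j" "p l"] orient_swap[of "p j" "p l" "p i"] by simp
    then show ?thesis
      using that orientD[of i j l] orientD[of j i l] by (cases "i < j") auto
  qed
  consider "i < l" "j < l" | "l < j" "i < j" | "l < i" "j < i" using assms by linarith
  then show ?thesis
  proof cases
    case 1 then show ?thesis using assms by (intro *) auto
  next
    case 2
    then have "orient (p l) (p i) (p j) \<noteq> 0" using assms by (intro *) auto
    then show ?thesis using orient_rotate[of "p l" "p i" "p j"] by simp
  next
    case 3
    then have "orient (p j) (p l) (p i) \<noteq> 0" using assms by (intro *) auto
    then show ?thesis using orient_rotate[of "p i" "p j" "p l"] by simp
  qed
qed

lemma vertices_inj: "inj_on p {..<k}"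
proof (rule inj_onI, rule ccontr)
  fix i j assume ij: "i \<in> {..<k}" "j \<in> {..<k}" "p i = p j" "i \<noteq> j"
  have "card {i, j} \<le> 2" by (simp add: card_insert_if)
  then have "\<not> {..<k} \<subseteq> {i, j}"
    using k3 card_mono[of "{i, j}" "{..<k}"] by auto
  then obtain l where "l < k" "l \<noteq> i" "l \<noteq> j" by auto
  then show False using vertices_not_collinear[of i j l] ij by auto
qed

lemma orient_consecutive:
  assumes "i < k" "l < k" "l \<noteq> i" "l \<noteq> after i"
  shows "orient (p i) (p (after i)) (p l) > 0"
proof (cases "Suc i = k")
  case True
  then have "after i = 0" "0 < l" "l < i" using assms by auto
  then show ?thesis using orientD[of 0 l i] True orient_rotate[of "p i" "p 0" "p l"] by simp
next
  case False
  then have n: "after i = Suc i" "Suc i < k" using assms by auto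
  show ?thesis
  proof (cases "l < i")
    case True
    then show ?thesis using orientD[of l i "Suc i"] n orient_rotate[of "p l" "p i" "p (Suc i)"] by simp
  next
    case False
    then show ?thesis using orientD[of i "Suc i" l] n assms by simp
  qed
qed

text \<open>
  The line through two vertices that are not neighbours has vertices strictly on both sides, one from
  each of the two arcs between them. So a diagonal cannot be an edge.
\<close>

lemma diagonal_separates:
  assumes "i < j" "j < k" "after i \<noteq> j" "after j \<noteq> i"
  obtains l l' where "l < k" "l' < k" "orient (p i) (p j) (p l) < 0" "orient (p i) (p j) (p l') > 0"
proof -
  have 1: "Suc i < j" using assms by auto
  have neg: "orient (p i) (p j) (p (Suc i)) < 0"
    using orientD[of i "Suc i" j] 1 assms orient_swap[of "p i" "p j" "p (Suc i)"] by simp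
  show thesis
  proof (cases "i = 0")
    case True
    then have "Suc j < k" using assms by (cases "Suc j = k") auto
    then show thesis using that[of "Suc i" "Suc j"] neg 1 assms orientD[of i j "Suc j"] by simp
  next
    case False
    then show thesis using that[of "Suc i" 0] neg 1 assms orientD[of 0 i j]
        orient_rotate[of "p 0" "p i" "p j"] by simp
  qed
qed

lemma after_neq: "i < k \<Longrightarrow> after i < k \<and> after i \<noteq> i"
  using k3 by (cases "Suc i = k") auto

text \<open>
  All other vertices lie strictly to the left of the line from a vertex to its successor. So this line
  supports the hull, and the face that it cuts out is spanned by the two vertices alone.
\<close>

lemma consecutive_edge:
  assumes i: "i < k"
  shows "closed_segment (p i) (p (after i)) edge_of convex hull (p ` {..<k})"
proof -
  let ?H = "convex hull (p ` {..<k})" and ?a = "p i" and ?b = "p (after i)"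
  define w :: "real ^ 2" where "w = vector [?a $ 2 - ?b $ 2, ?b $ 1 - ?a $ 1]"
  have w: "orient ?a ?b c = w \<bullet> c - w \<bullet> ?a" for c unfolding w_def by (rule orient_eq_inner)
  have nx: "after i < k" "after i \<noteq> i" using after_neq[OF i] by auto
  have ge: "w \<bullet> p l \<ge> w \<bullet> ?a" if "l < k" for l
    using orient_consecutive[OF i that] w[of "p l"] w[of ?b]
    by (cases "l = i \<or> l = after i") auto
  have "?H \<subseteq> {x. w \<bullet> x \<ge> w \<bullet> ?a}"
    using ge by (intro hull_minimal) (auto simp: convex_halfspace_ge)
  then have face: "?H \<inter> {x. w \<bullet> x = w \<bullet> ?a} face_of ?H"
    by (intro face_of_Int_supporting_hyperplane_ge) auto
  then obtain S where S: "S \<subseteq> p ` {..<k}" "?H \<inter> {x. w \<bullet> x = w \<bullet> ?a} = convex hull S"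
    by (rule face_of_convex_hull_subset[rotated]) (auto intro: finite_imp_compact)
  have "S \<subseteq> {?a, ?b}"
  proof
    fix x assume "x \<in> S"
    then obtain l where l: "x = p l" "l < k" using S(1) by auto
    have "x \<in> convex hull S" using \<open>x \<in> S\<close> by (rule hull_inc)
    then have "w \<bullet> x = w \<bullet> ?a" using S(2) by auto
    then have "orient ?a ?b (p l) = 0" using w[of "p l"] l by simp
    then show "x \<in> {?a, ?b}" using orient_consecutive[OF i l(2)] l(1) by fastforce
  qed
  then have "convex hull S \<subseteq> closed_segment ?a ?b"
    unfolding segment_convex_hull by (rule hull_mono)
  moreover have "closed_segment ?a ?b \<subseteq> ?H \<inter> {x. w \<bullet> x = w \<bullet> ?a}"
    unfolding segment_convex_hull
    using i nx w[of ?b] by (intro hull_minimal) (auto intro: hull_inc simp: convex_Int convex_hyperplane)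
  ultimately have "?H \<inter> {x. w \<bullet> x = w \<bullet> ?a} = closed_segment ?a ?b" using S(2) by auto
  moreover have "?a \<noteq> ?b" using vertices_inj i nx by (auto dest: inj_onD)
  ultimately show ?thesis
    using face by (simp add: edge_of_def segment_convex_hull aff_dim_convex_hull)
qed

lemma interior_hull_nonempty: "interior (convex hull (p ` {..<k})) \<noteq> {}"
proof
  let ?H = "convex hull (p ` {..<k})"
  assume "interior ?H = {}"
  then obtain w c where w: "w \<noteq> 0" "?H \<subseteq> {x. w \<bullet> x = c}"
    using empty_interior_subset_hyperplane[of ?H] by auto
  have c: "w \<bullet> p l = c" if "l < k" for l using w(2) that hull_inc[of "p l" "p ` {..<k}"] by blast
  have "p 0 \<noteq> p 1" using vertices_inj k3 by (auto dest: inj_onD)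
  then obtain d where "d \<noteq> 0" "\<And>r. w \<bullet> r - c = d * orient (p 0) (p 1) r"
    using hyperplane_through_two_points[OF w(1), of "p 0" "p 1" c] c k3 by auto
  from this(1) this(2)[of "p 2"] show False using vertices_not_collinear[of 0 1 2] c[of 2] k3 by simp
qed

lemma convex_polygon_hull: "convex_polygon (convex hull (p ` {..<k}))"
  using interior_hull_nonempty by (auto simp: convex_polygon_def polytope_def)

text \<open>
  An edge is spanned by two vertices and exposed by a supporting line through both of them. A third
  vertex on that line is impossible, and a diagonal would separate the remaining vertices.
\<close>

lemma edge_consecutive:
  assumes e: "e edge_of convex hull (p ` {..<k})"
  shows "\<exists>i<k. e = closed_segment (p i) (p (after i))"
proof -
  let ?H = "convex hull (p ` {..<k})"
  have face: "e face_of ?H" and dim: "aff_dim e = 1" using e by (auto simp: edge_of_def)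
  obtain S where S: "S \<subseteq> p ` {..<k}" "e = convex hull S"
    using face by (rule face_of_convex_hull_subset[rotated]) (auto intro: finite_imp_compact)
  obtain w c where w: "w \<noteq> 0" "?H \<subseteq> {x. w \<bullet> x \<le> c}" "e = ?H \<inter> {x. w \<bullet> x = c}"
    using side_supporting_line[OF convex_polygon_hull, of e] e by (auto simp: sides_def)
  have le: "w \<bullet> p l \<le> c" if "l < k" for l using w(2) that hull_inc[of "p l" "p ` {..<k}"] by blast
  have on: "w \<bullet> x = c" if "x \<in> S" for x using w(3) S(2) that hull_inc[of x S] by blast
  have "\<not> (\<exists>a. S \<subseteq> {a})"
  proof
    assume "\<exists>a. S \<subseteq> {a}"
    then have "S = {} \<or> (\<exists>a. S = {a})" by (auto simp: subset_singleton_iff)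
    then show False using dim S(2) by (auto simp: aff_dim_convex_hull)
  qed
  then obtain x y where xy: "x \<in> S" "y \<in> S" "x \<noteq> y" by blast
  then have "x \<in> p ` {..<k}" "y \<in> p ` {..<k}" using S(1) by blast+
  then obtain i' j' where ij': "x = p i'" "y = p j'" "i' < k" "j' < k" by blast
  obtain i j where ij: "i < j" "j < k" "p i \<in> S" "p j \<in> S" "{p i, p j} = {x, y}"
  proof (cases i' j' rule: linorder_cases)
    case less then show thesis using that[of i' j'] xy ij' by auto
  next
    case equal then show thesis using xy ij' by auto
  next
    case greater then show thesis using that[of j' i'] xy ij' by auto
  qed
  have "p i \<noteq> p j" using vertices_inj ij by (auto dest: inj_onD)
  then obtain d where d: "d \<noteq> 0" "\<And>r. w \<bullet> r - c = d * orient (p i) (p j) r"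
    using hyperplane_through_two_points[OF w(1), of "p i" "p j" c] on ij by auto
  have "S \<subseteq> {p i, p j}"
  proof
    fix z assume "z \<in> S"
    then obtain l where l: "z = p l" "l < k" using S(1) by auto
    have "orient (p i) (p j) (p l) = 0" using d(1) d(2)[of z] on[OF \<open>z \<in> S\<close>] l by simp
    then show "z \<in> {p i, p j}" using vertices_not_collinear[of i j l] ij l by auto
  qed
  then have "S = {p i, p j}" using ij(3,4) by blast
  then have e_seg: "e = closed_segment (p i) (p j)" using S(2) by (simp add: segment_convex_hull)
  have "after i = j \<or> after j = i"
  proof (rule ccontr)
    assume "\<not> ?thesis"
    then obtain l l' where l: "l < k" "l' < k" "orient (p i) (p j) (p l) < 0" "orient (p i) (p j) (p l') > 0"
      using diagonal_separates[OF ij(1,2)] by blast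
    have "d * orient (p i) (p j) (p l) \<le> 0" "d * orient (p i) (p j) (p l') \<le> 0"
      using le[OF l(1)] le[OF l(2)] d(2)[of "p l"] d(2)[of "p l'"] by linarith+
    then show False using d(1) l(3,4) by (auto simp: mult_le_0_iff)
  qed
  then show ?thesis
  proof
    assume "after i = j"
    then show ?thesis using e_seg ij by (intro exI[of _ i]) auto
  next
    assume "after j = i"
    then show ?thesis using e_seg ij closed_segment_commute by (intro exI[of _ j]) auto
  qed
qed

lemma sides_hull:
  "bij_betw (\<lambda>i. closed_segment (p i) (p (after i))) {..<k} (sides (convex hull (p ` {..<k})))"
  unfolding bij_betw_def
proof
  show "inj_on (\<lambda>i. closed_segment (p i) (p (after i))) {..<k}"
  proof (rule inj_onI)
    fix i j assume ij: "i \<in> {..<k}" "j \<in> {..<k}"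
      and "closed_segment (p i) (p (after i)) = closed_segment (p j) (p (after j))"
    then have "{p i, p (after i)} = {p j, p (after j)}" by simp
    then have "p ` {i, after i} = p ` {j, after j}" by simp
    then have eq: "{i, after i} = {j, after j}"
      using inj_on_image_eq_iff[OF vertices_inj, of "{i, after i}" "{j, after j}"] ij after_neq by auto
    show "i = j"
    proof (rule ccontr)
      assume "i \<noteq> j"
      \<comment> \<open>Two vertices that succeed each other would form a cycle of length 2, but \<open>k \<ge> 3\<close>.\<close>
      then have "after i = j" "after j = i" using eq by (auto simp: doubleton_eq_iff)
      then show False using ij k3 by (cases "Suc i = k"; cases "Suc j = k") auto
    qed
  qed
  show "(\<lambda>i. closed_segment (p i) (p (after i))) ` {..<k} = sides (convex hull (p ` {..<k}))"
    using consecutive_edge edge_consecutive by (auto simp: sides_def)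
qed

end

lemma forms_polygonI:
  assumes "convex_position k p" "k \<ge> 3"
    and len: "\<And>i. i < k \<Longrightarrow> dist (p i) (p (Suc i mod k)) = real (x (Suc i))"
  shows "forms_polygon k x"
proof -
  let ?H = "convex hull (p ` {..<k})" and ?s = "\<lambda>i. closed_segment (p i) (p (Suc i mod k))"
  have bij: "bij_betw ?s {..<k} (sides ?H)" using sides_hull[OF assms(1,2)] .
  have sh: "bij_betw Suc {..<k} {1..k}"
    by (rule bij_betwI[of _ _ _ "\<lambda>i. i - 1"]) auto
  have "side_lengths ?H = image_mset diameter (image_mset ?s (mset_set {..<k}))"
    using bij unfolding side_lengths_def bij_betw_def by (simp add: image_mset_mset_set)
  also have "\<dots> = image_mset (\<lambda>i. real (x (Suc i))) (mset_set {..<k})"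
    unfolding multiset.map_comp
    by (rule image_mset_cong) (simp add: diameter_closed_segment len)
  also have "\<dots> = image_mset (\<lambda>i. real (x i)) (image_mset Suc (mset_set {..<k}))"
    by (simp add: multiset.map_comp comp_def)
  also have "\<dots> = image_mset (\<lambda>i. real (x i)) (mset_set {1..k})"
    using sh unfolding bij_betw_def by (simp add: image_mset_mset_set)
  finally show ?thesis
    unfolding forms_polygon_def
    using convex_polygon_hull[OF assms(1,2)] bij_betw_same_card[OF bij]
    by (intro exI[of _ ?H]) simp
qed

section \<open>Polygons inscribed in a circle\<close>

text \<open>
  The parameter is half of the polar angle. By the inscribed angle theorem all chords and orientation
  determinants are then products of sines of differences of parameters.
\<close>

definition circle_point :: "real \<Rightarrow> real \<Rightarrow> real ^ 2" where
  "circle_point R s = vector [R * cos (2 * s), R * sin (2 * s)]"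

lemma circle_point_diff:
  "circle_point R t $ 1 - circle_point R s $ 1 = - 2 * R * sin (t + s) * sin (t - s)"
  "circle_point R t $ 2 - circle_point R s $ 2 = 2 * R * cos (t + s) * sin (t - s)"
proof -
  have "cos (2 * t) - cos (2 * s) = - 2 * sin (t + s) * sin (t - s)"
    using cos_diff_cos[of "2 * t" "2 * s"] sin_minus[of "t - s"] by (simp add: add_divide_distrib diff_divide_distrib)
  moreover have "circle_point R t $ 1 - circle_point R s $ 1 = R * (cos (2 * t) - cos (2 * s))"
    by (simp add: circle_point_def right_diff_distrib)
  ultimately show "circle_point R t $ 1 - circle_point R s $ 1 = - 2 * R * sin (t + s) * sin (t - s)" by simp
  have "sin (2 * t) - sin (2 * s) = 2 * cos (t + s) * sin (t - s)"
    using sin_diff_sin[of "2 * t" "2 * s"] by (simp add: add_divide_distrib diff_divide_distrib)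
  moreover have "circle_point R t $ 2 - circle_point R s $ 2 = R * (sin (2 * t) - sin (2 * s))"
    by (simp add: circle_point_def right_diff_distrib)
  ultimately show "circle_point R t $ 2 - circle_point R s $ 2 = 2 * R * cos (t + s) * sin (t - s)" by simp
qed

lemma dist_circle_point:
  assumes "R > 0"
  shows "dist (circle_point R s) (circle_point R t) = 2 * R * \<bar>sin (s - t)\<bar>"
proof -
  have "(dist (circle_point R s) (circle_point R t))\<^sup>2
      = (2 * R * sin (s - t))\<^sup>2 * ((sin (s + t))\<^sup>2 + (cos (s + t))\<^sup>2)"
    unfolding dist_norm norm_real2_sq vector_minus_component circle_point_diff
    by algebra
  also have "\<dots> = (2 * R * \<bar>sin (s - t)\<bar>)\<^sup>2" by (simp add: power_mult_distrib)
  finally show ?thesis using assms by (simp add: power2_eq_iff_nonneg)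
qed

lemma orient_circle_points:
  "orient (circle_point R s) (circle_point R t) (circle_point R v)
    = 4 * R\<^sup>2 * sin (t - s) * sin (v - s) * sin (v - t)"
proof -
  have "sin (v - t) = sin ((v + s) - (t + s))" by simp
  also have "\<dots> = sin (v + s) * cos (t + s) - cos (v + s) * sin (t + s)" by (rule sin_diff)
  finally have v: "sin (v - t) = sin (v + s) * cos (t + s) - cos (v + s) * sin (t + s)" .
  show ?thesis
    unfolding orient_def circle_point_diff v by (simp add: algebra_simps power2_eq_square)
qed

text \<open>
  The vertices have as parameters the partial sums \<open>s i\<close> of the half central angles. These increase from
  \<open>0\<close> to \<open>\<pi>\<close>, so all differences that enter an orientation determinant lie in \<open>(0, \<pi>)\<close> and have
  positive sine. The closing side joins the parameters \<open>\<pi> - \<alpha> k\<close> and \<open>0\<close>, and \<open>sin (\<pi> - \<alpha> k) = sin (\<alpha> k)\<close>.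
\<close>

lemma inscribed_polygon:
  assumes "k \<ge> 3" and R: "R > 0" and sum: "sum \<alpha> {1..k} = pi"
    and pos: "\<And>i. i \<in> {1..k} \<Longrightarrow> 0 < \<alpha> i"
    and len: "\<And>i. i \<in> {1..k} \<Longrightarrow> real (x i) = 2 * R * sin (\<alpha> i)"
  shows "forms_polygon k x"
proof -
  define s where "s = (\<lambda>i. \<Sum>j\<in>{1..i}. \<alpha> j)"
  have Suc: "s (Suc i) = s i + \<alpha> (Suc i)" for i by (simp add: s_def)
  have ends: "s 0 = 0" "s k = pi" using sum by (simp_all add: s_def)
  have less: "s i < s j" if "i < j" "j \<le> k" for i j
  proof -
    have "(\<Sum>j\<in>{1..i}. \<alpha> j) < (\<Sum>j\<in>{1..j}. \<alpha> j)"
      using that pos by (intro sum_strict_mono2[of _ _ j]) (auto intro: less_imp_le)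
    then show ?thesis by (simp add: s_def)
  qed
  show ?thesis
  proof (rule forms_polygonI[of k "\<lambda>i. circle_point R (s i)"])
    show "convex_position k (\<lambda>i. circle_point R (s i))"
      unfolding convex_position_def
    proof (intro allI impI)
      fix i j l :: nat assume ijl: "i < j" "j < l" "l < k"
      have "0 \<le> s i" using less[of 0 i] ends ijl by (cases "i = 0") auto
      moreover have "s i < s j" "s j < s l" "s l < pi"
        using less[of i j] less[of j l] less[of l k] ends ijl by auto
      ultimately have "sin (s j - s i) > 0" "sin (s l - s i) > 0" "sin (s l - s j) > 0"
        by (auto intro!: sin_gt_zero)
      then show "orient (circle_point R (s i)) (circle_point R (s j)) (circle_point R (s l)) > 0"
        unfolding orient_circle_points using R by simp
    qed
    show "dist (circle_point R (s i)) (circle_point R (s (Suc i mod k))) = real (x (Suc i))"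
      if i: "i < k" for i
    proof -
      have "\<bar>sin (s i - s (Suc i mod k))\<bar> = \<bar>sin (\<alpha> (Suc i))\<bar>"
      proof (cases "Suc i = k")
        case True
        then have "s i - s (Suc i mod k) = pi - \<alpha> (Suc i)" using Suc[of i] ends by simp
        then show ?thesis by simp
      next
        case False
        then have "s i - s (Suc i mod k) = - \<alpha> (Suc i)" using Suc[of i] i by simp
        then show ?thesis by simp
      qed
      moreover have xi: "real (x (Suc i)) = 2 * R * sin (\<alpha> (Suc i))" using len[of "Suc i"] i by simp
      moreover have "sin (\<alpha> (Suc i)) \<ge> 0"
      proof -
        have "0 \<le> real (x (Suc i))" by simp
        then have "0 \<le> 2 * R * sin (\<alpha> (Suc i))" by (simp only: xi)
        then show ?thesis using R by (simp add: zero_le_mult_iff)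
      qed
      ultimately show ?thesis by (simp add: dist_circle_point[OF R])
    qed
  qed (rule assms(1))
qed

text \<open>
  Let \<open>m\<close> be the index of a longest stick and \<open>t = 1 / (2 * R)\<close>, so that the stick \<open>i\<close> spans the half
  central angle \<open>A i t = arcsin (l i * t)\<close> or its supplement. The smallest circle is the one that has the
  longest stick as diameter, \<open>t = 1 / l m\<close>. If the half angles there add up to at least \<open>\<pi>\<close>, then
  somewhere between this circle and \<open>t = 0\<close>, where the sum is \<open>0\<close>, it equals \<open>\<pi>\<close>, and the centre lies in
  the polygon. Otherwise the longest stick has to cut off the centre and to span the supplement
  \<open>\<pi> - A m t\<close>, so that the condition becomes \<open>G t = 0\<close>, where \<open>G t\<close> is the sum of the other half angles
  minus \<open>A m t\<close>. By the case assumption \<open>G\<close> is negative at \<open>1 / l m\<close>, and for small \<open>t > 0\<close> it is positive,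
  because its derivative at \<open>0\<close> is the sum of the other lengths minus \<open>l m\<close>. This is where the hypothesis
  on the lengths enters.
\<close>

lemma sticks_as_chords:
  fixes l :: "'a \<Rightarrow> real"
  assumes fin: "finite I" and pos: "\<And>i. i \<in> I \<Longrightarrow> l i > 0"
    and ineq: "\<And>i. i \<in> I \<Longrightarrow> l i < sum l (I - {i})" and ne: "I \<noteq> {}"
  obtains R \<alpha> where "R > 0" "sum \<alpha> I = pi"
    "\<And>i. i \<in> I \<Longrightarrow> 0 < \<alpha> i" "\<And>i. i \<in> I \<Longrightarrow> l i = 2 * R * sin (\<alpha> i)"
proof -
  have "Max (l ` I) \<in> l ` I" using fin ne by (intro Max_in) auto
  then obtain m where m: "m \<in> I" "l m = Max (l ` I)" by auto
  have le: "l i \<le> l m" if "i \<in> I" for i using m fin that by simp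
  define t1 where "t1 = 1 / l m"
  have t1: "t1 > 0" using pos[OF m(1)] by (simp add: t1_def)
  define A where "A = (\<lambda>i t. arcsin (l i * t))"
  have rng: "0 \<le> l i * t \<and> l i * t \<le> 1" if "i \<in> I" "0 \<le> t" "t \<le> t1" for i t
  proof -
    have "l i * t \<le> l m * t1" using that le[of i] pos[of i] pos[OF m(1)] by (intro mult_mono) auto
    also have "\<dots> = 1" using pos[OF m(1)] by (simp add: t1_def)
    finally show ?thesis using that pos[of i] by simp
  qed
  have cont: "continuous_on {0..t1} (A i)" if "i \<in> I" for i
    unfolding A_def using rng[OF that] by (intro continuous_intros) (auto intro: order_trans[of _ 0])
  have A0: "A i 0 = 0" for i by (simp add: A_def)
  have Am: "A m t1 = pi / 2" using pos[OF m(1)] by (simp add: A_def t1_def)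
  have Apos: "0 < A i t" and sinA: "sin (A i t) = l i * t"
    if "i \<in> I" "0 < t" "t \<le> t1" for i t
  proof -
    have r: "0 < l i * t" "l i * t \<le> 1" using rng[of i t] pos[of i] that by auto
    show "0 < A i t" using arcsin_less_arcsin[of 0 "l i * t"] r by (simp add: A_def)
    show "sin (A i t) = l i * t" using r by (simp add: A_def)
  qed
  have split: "sum f I = f m + sum f (I - {m})" for f :: "'a \<Rightarrow> real"
    using fin m by (simp add: sum.remove)
  show ?thesis
  proof (cases "(\<Sum>i\<in>I - {m}. A i t1) \<ge> pi / 2")
    case True
    have "\<exists>t. 0 \<le> t \<and> t \<le> t1 \<and> (\<Sum>i\<in>I. A i t) = pi"
    proof (rule IVT')
      show "(\<Sum>i\<in>I. A i 0) \<le> pi" by (simp add: A0)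
      show "pi \<le> (\<Sum>i\<in>I. A i t1)" using True Am split[of "\<lambda>i. A i t1"] by simp
    qed (use t1 cont in \<open>auto intro!: continuous_on_sum\<close>)
    then obtain t where t: "0 \<le> t" "t \<le> t1" "(\<Sum>i\<in>I. A i t) = pi" by auto
    have "t \<noteq> 0" using t by (auto simp: A0)
    then have t0: "t > 0" using t by simp
    show ?thesis
    proof (rule that[of "1 / (2 * t)" "\<lambda>i. A i t"])
      show "l i = 2 * (1 / (2 * t)) * sin (A i t)" if "i \<in> I" for i
        using sinA[OF that t0 t(2)] t0 by simp
    qed (use t t0 Apos in auto)
  next
    case False
    define G where "G = (\<lambda>t. (\<Sum>i\<in>I - {m}. A i t) - A m t)"
    have "((\<lambda>t. A i t) has_real_derivative l i) (at 0)" for i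
      unfolding A_def by (auto intro!: derivative_eq_intros)
    then have "(G has_real_derivative (\<Sum>i\<in>I - {m}. l i) - l m) (at 0)"
      unfolding G_def by (intro DERIV_diff DERIV_sum) auto
    from DERIV_pos_inc_right[OF this] ineq[OF m(1)]
    obtain d where d: "d > 0" "\<And>h. 0 < h \<Longrightarrow> h < d \<Longrightarrow> G 0 < G h" by auto
    define t0 where "t0 = min (d / 2) t1"
    have t0: "0 < t0" "t0 < d" "t0 \<le> t1" using d(1) t1 by (auto simp: t0_def)
    have "G 0 = 0" by (simp add: G_def A0)
    then have G0: "0 \<le> G t0" using d(2)[OF t0(1,2)] by simp
    have "\<exists>t. t0 \<le> t \<and> t \<le> t1 \<and> G t = 0"
    proof (rule IVT2')
      show "G t1 \<le> 0" using False Am by (simp add: G_def)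
      have "continuous_on {0..t1} G"
        unfolding G_def using cont m(1) by (auto intro!: continuous_on_diff continuous_on_sum)
      then show "continuous_on {t0..t1} G" by (rule continuous_on_subset) (use t0 in auto)
    qed (use t0 G0 in auto)
    then obtain t where t: "t0 \<le> t" "t \<le> t1" "G t = 0" by auto
    have tp: "t > 0" using t0 t by simp
    define \<alpha> where "\<alpha> = (\<lambda>i. if i = m then pi - A m t else A i t)"
    show ?thesis
    proof (rule that[of "1 / (2 * t)" \<alpha>])
      have "sum \<alpha> (I - {m}) = (\<Sum>i\<in>I - {m}. A i t)" by (rule sum.cong) (auto simp: \<alpha>_def)
      then show "sum \<alpha> I = pi" using t(3) split[of \<alpha>] by (simp add: G_def \<alpha>_def)
      have "A m t \<le> pi / 2" unfolding A_def using rng[OF m(1), of t] tp t(2)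
        by (intro arcsin_ubound) auto
      then have "A m t < pi" using pi_gt_zero by linarith
      then show "0 < \<alpha> i" if "i \<in> I" for i using Apos[OF that tp t(2)] by (simp add: \<alpha>_def)
      show "l i = 2 * (1 / (2 * t)) * sin (\<alpha> i)" if "i \<in> I" for i
        using sinA[OF that tp t(2)] tp by (auto simp: \<alpha>_def)
    qed (use tp in auto)
  qed
qed

lemma forms_polygon_iff:
  assumes "k \<ge> 3" and pos: "\<And>i. i \<in> {1..k} \<Longrightarrow> x i > 0"
  shows "forms_polygon k x \<longleftrightarrow> (\<forall>i\<in>{1..k}. x i < sum x ({1..k} - {i}))"
proof
  assume "forms_polygon k x"
  then show "\<forall>i\<in>{1..k}. x i < sum x ({1..k} - {i})" using forms_polygonD by blast
next
  assume ineq: "\<forall>i\<in>{1..k}. x i < sum x ({1..k} - {i})"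
  have "real (x i) < (\<Sum>j\<in>{1..k} - {i}. real (x j))" if "i \<in> {1..k}" for i
    using ineq that by (simp flip: of_nat_sum)
  moreover have "{1..k} \<noteq> {}" using assms(1) by simp
  ultimately obtain R \<alpha> where "R > 0" "sum \<alpha> {1..k} = pi"
    "\<And>i. i \<in> {1..k} \<Longrightarrow> 0 < \<alpha> i" "\<And>i. i \<in> {1..k} \<Longrightarrow> real (x i) = 2 * R * sin (\<alpha> i)"
    using sticks_as_chords[of "{1..k}" "\<lambda>i. real (x i)"] pos by (metis finite_atLeastAtMost of_nat_0_less_iff)
  then show "forms_polygon k x" by (rule inscribed_polygon[OF assms(1)])
qed

section \<open>Counting the vectors with a dominant stick\<close>

text \<open>
  Fixing the value \<open>v\<close> at one index leaves the same problem with bound \<open>m - v\<close>, and the sum over \<open>v\<close> is a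
  hockey stick sum of binomial coefficients.
\<close>

lemma card_positive_vectors_sum_le:
  fixes J :: "'a set" and m :: nat
  assumes "finite J"
  shows "finite {f \<in> J \<rightarrow>\<^sub>E {1..}. sum f J \<le> m} \<and>
         card {f \<in> J \<rightarrow>\<^sub>E {1..}. sum f J \<le> m} = m choose card J"
  using assms
proof (induction J arbitrary: m rule: finite_induct)
  case empty
  have "{f. f = (\<lambda>x. undefined) \<and> sum f {} \<le> m} = {\<lambda>x::'a. undefined::nat}"
    by auto
  then show ?case by (simp add: PiE_empty_domain)
next
  case (insert j J)
  let ?T = "\<lambda>J m. {f \<in> J \<rightarrow>\<^sub>E {1..}. sum f J \<le> (m::nat)}"
  let ?upd = "\<lambda>(y, g). g(j := y)"
  have sum_upd: "sum (g(j := y)) (insert j J) = y + sum g J" for g and y :: nat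
  proof -
    have "sum (g(j := y)) J = sum g J"
      using insert.hyps(2) by (intro sum.cong) auto
    then show ?thesis using insert.hyps by simp
  qed
  have eq: "?T (insert j J) m = ?upd ` (SIGMA v:{1..m}. ?T J (m - v))"
  proof (intro equalityI subsetI)
    fix f assume "f \<in> ?T (insert j J) m"
    then have f: "f \<in> ?upd ` ({1..} \<times> (J \<rightarrow>\<^sub>E {1..}))" and le: "sum f (insert j J) \<le> m"
      by (simp_all only: PiE_insert_eq mem_Collect_eq)
    then obtain v g where vg: "f = g(j := v)" "v \<ge> 1" "g \<in> J \<rightarrow>\<^sub>E {1..}" by auto
    have "v + sum g J \<le> m" using le sum_upd[of g v] by (simp only: vg)
    then have "(v, g) \<in> (SIGMA v:{1..m}. ?T J (m - v))" using vg by auto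
    then show "f \<in> ?upd ` (SIGMA v:{1..m}. ?T J (m - v))" using vg(1) by force
  next
    fix f assume "f \<in> ?upd ` (SIGMA v:{1..m}. ?T J (m - v))"
    then obtain v g where vg: "f = g(j := v)" "v \<ge> 1" "v \<le> m" "g \<in> J \<rightarrow>\<^sub>E {1..}" "sum g J \<le> m - v"
      by auto
    have "f \<in> insert j J \<rightarrow>\<^sub>E {1..}"
      unfolding PiE_insert_eq using vg by (intro image_eqI[of _ _ "(v, g)"]) auto
    moreover have "sum f (insert j J) \<le> m" unfolding vg(1) sum_upd using vg by simp
    ultimately show "f \<in> ?T (insert j J) m" by simp
  qed
  have inj: "inj_on ?upd (SIGMA v:{1..m}. ?T J (m - v))"
    by (rule inj_on_subset[OF inj_combinator[OF insert.hyps(2), of "\<lambda>_. {1..}"]]) auto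
  have "card (?T (insert j J) m) = (\<Sum>v\<in>{1..m}. card (?T J (m - v)))"
    unfolding eq card_image[OF inj] using insert.IH by (intro card_SigmaI) auto
  also have "\<dots> = (\<Sum>v\<in>{1..m}. (m - v) choose card J)"
    using insert.IH by simp
  also have "\<dots> = (\<Sum>u<m. u choose card J)"
    by (rule sum.reindex_bij_witness[of _ "\<lambda>u. m - u" "\<lambda>v. m - v"]) auto
  also have "\<dots> = m choose Suc (card J)"
    by (cases m) (simp_all add: lessThan_Suc_atMost sum_choose_upper del: binomial_Suc_Suc)
  finally show ?case
    using insert.IH insert.hyps unfolding eq by auto
qed

text \<open>
  The dominant stick may have any length \<open>m \<le> n\<close>, and then the bound \<open>n\<close> on the other sticks follows from
  the bound \<open>m\<close> on their sum. The counts \<open>m choose (k - 1)\<close> add up to \<open>(n + 1) choose k\<close>; extending the sum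
  to \<open>m = 0\<close> is harmless only for \<open>k \<ge> 2\<close>, as \<open>0 choose 0 = 1\<close>.
\<close>

lemma card_dominant_stick:
  assumes "i \<in> {1..k}" "k \<ge> 2"
  shows "card {x \<in> stick_lengths n k. sum x ({1..k} - {i}) \<le> x i} = (n + 1) choose k"
proof -
  let ?J = "{1..k} - {i}"
  let ?T = "\<lambda>m. {f \<in> ?J \<rightarrow>\<^sub>E {1..}. sum f ?J \<le> (m::nat)}"
  let ?upd = "\<lambda>(y, g). g(i := y)"
  have ins: "{1..k} = insert i ?J" using assms by auto
  have sum_upd: "sum (g(i := v)) ?J = sum g ?J" for g and v :: nat
    by (intro sum.cong) auto
  have T: "finite (?T m)" "card (?T m) = m choose card ?J" for m
    using card_positive_vectors_sum_le[of ?J m] by auto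
  have eq: "{x \<in> stick_lengths n k. sum x ?J \<le> x i} = ?upd ` (SIGMA m:{1..n}. ?T m)"
  proof (intro equalityI subsetI)
    fix x assume "x \<in> {x \<in> stick_lengths n k. sum x ?J \<le> x i}"
    then have x: "x \<in> insert i ?J \<rightarrow>\<^sub>E {1..n}" and le: "sum x ?J \<le> x i"
      unfolding stick_lengths_def ins[symmetric] by auto
    from x obtain v g where vg: "x = g(i := v)" "v \<in> {1..n}" "g \<in> ?J \<rightarrow>\<^sub>E {1..n}"
      unfolding PiE_insert_eq by auto
    have "sum g ?J \<le> v" using le sum_upd[of g v] unfolding vg(1) by simp
    moreover have "g \<in> ?J \<rightarrow>\<^sub>E {1..}" using vg(3) by (auto simp: PiE_iff)
    ultimately show "x \<in> ?upd ` (SIGMA m:{1..n}. ?T m)"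
      using vg by (intro image_eqI[of _ _ "(v, g)"]) auto
  next
    fix x assume "x \<in> ?upd ` (SIGMA m:{1..n}. ?T m)"
    then obtain v g where vg: "x = g(i := v)" "v \<in> {1..n}" "g \<in> ?J \<rightarrow>\<^sub>E {1..}" "sum g ?J \<le> v"
      by auto
    have "g j \<le> n" if "j \<in> ?J" for j
      using member_le_sum[of j ?J g] that vg by auto
    then have "g \<in> ?J \<rightarrow>\<^sub>E {1..n}" using vg(3) by (auto simp: PiE_iff)
    then have "x \<in> insert i ?J \<rightarrow>\<^sub>E {1..n}"
      unfolding PiE_insert_eq using vg by (intro image_eqI[of _ _ "(v, g)"]) auto
    then have "x \<in> stick_lengths n k" unfolding stick_lengths_def ins[symmetric] .
    moreover have "sum x ?J \<le> x i" unfolding vg(1) sum_upd using vg by simp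
    ultimately show "x \<in> {x \<in> stick_lengths n k. sum x ?J \<le> x i}" by simp
  qed
  have inj: "inj_on ?upd (SIGMA m:{1..n}. ?T m)"
    by (rule inj_on_subset[OF inj_combinator[of i ?J "\<lambda>_. {1..}"]])
      (simp, intro Sigma_mono Collect_subset, auto)
  have "card (SIGMA m:{1..n}. ?T m) = (\<Sum>m\<in>{1..n}. card (?T m))"
    by (rule card_SigmaI) (use T(1) in blast)+
  then have "card {x \<in> stick_lengths n k. sum x ?J \<le> x i} = (\<Sum>m\<in>{1..n}. m choose card ?J)"
    unfolding eq card_image[OF inj] by (simp only: T(2))
  also have "\<dots> = (\<Sum>m\<in>{1..n}. m choose (k - 1))"
    using assms by (simp add: card_Diff_singleton)
  also have "\<dots> = (\<Sum>m\<le>n. m choose (k - 1))"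
    using assms(2) by (simp add: atMost_atLeast0 sum.atLeast_Suc_atMost)
  also have "\<dots> = (n + 1) choose k"
    using assms by (simp add: sum_choose_upper del: binomial_Suc_Suc)
  finally show ?thesis .
qed

text \<open>
  Each of two dominant sticks would be at least as long as the other one and a third stick together.
\<close>

lemma dominant_stick_unique:
  assumes "x \<in> stick_lengths n k" "k \<ge> 3" "i \<in> {1..k}" "j \<in> {1..k}"
    and "sum x ({1..k} - {i}) \<le> x i" "sum x ({1..k} - {j}) \<le> x j"
  shows "i = j"
proof (rule ccontr)
  assume "i \<noteq> j"
  have pos: "x l \<ge> 1" if "l \<in> {1..k}" for l
    using assms(1) that by (auto simp: stick_lengths_def PiE_iff)
  have "card ({1..k} - {i, j}) \<ge> 1"
    using assms(2-4) \<open>i \<noteq> j\<close> by (simp add: card_Diff_subset)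
  then obtain l where l: "l \<in> {1..k}" "l \<noteq> i" "l \<noteq> j"
    by (metis Diff_iff One_nat_def card.empty equals0I insertCI not_one_le_zero)
  have sub: "x a + x l \<le> sum x ({1..k} - {b})"
    if "a \<in> {1..k}" "a \<noteq> b" "l \<noteq> b" "a \<noteq> l" for a b
  proof -
    have "sum x {a, l} \<le> sum x ({1..k} - {b})"
      using that l by (intro sum_mono2) auto
    then show ?thesis using that by simp
  qed
  have "x j + x l \<le> sum x ({1..k} - {i})" "x i + x l \<le> sum x ({1..k} - {j})"
    using assms(3,4) l \<open>i \<noteq> j\<close> by (intro sub; blast)+
  then have "x j + x l \<le> x i" "x i + x l \<le> x j" using assms(5,6) by linarith+
  then show False using pos[OF l(1)] by simp
qed

section \<open>The probability\<close>

theorem theorem4: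
  fixes n k :: nat
  assumes "n \<ge> 1" and "k \<ge> 3"
  shows "measure_pmf.prob (pmf_of_set (stick_lengths n k)) {x. forms_polygon k x} =
           1 - real (k * ((n + 1) choose k)) / real (n ^ k)"
proof -
  let ?S = "stick_lengths n k"
  let ?A = "\<lambda>i. {x \<in> ?S. sum x ({1..k} - {i}) \<le> x i}"
  let ?B = "\<Union>i\<in>{1..k}. ?A i"
  have fin: "finite ?S" and card: "card ?S = n ^ k"
    unfolding stick_lengths_def by (simp_all add: finite_PiE card_PiE)
  have ne: "?S \<noteq> {}" using card assms(1) by auto
  have "card ?B = (\<Sum>i\<in>{1..k}. card (?A i))"
    using fin dominant_stick_unique[OF _ assms(2)] by (intro card_UN_disjoint) auto
  also have "\<dots> = k * ((n + 1) choose k)"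
    using card_dominant_stick[of _ k n] assms(2) by simp
  finally have cardB: "card ?B = k * ((n + 1) choose k)" .
  have sub: "?B \<subseteq> ?S" by auto
  have iff: "forms_polygon k x \<longleftrightarrow> (\<forall>i\<in>{1..k}. x i < sum x ({1..k} - {i}))" if "x \<in> ?S" for x
  proof (rule forms_polygon_iff[OF assms(2)])
    show "x i > 0" if "i \<in> {1..k}" for i
      using PiE_mem[OF \<open>x \<in> ?S\<close>[unfolded stick_lengths_def] that] by simp
  qed
  have "?S \<inter> {x. forms_polygon k x} = ?S - ?B"
  proof (rule set_eqI)
    show "x \<in> ?S \<inter> {x. forms_polygon k x} \<longleftrightarrow> x \<in> ?S - ?B" for x
      using iff[of x] by (cases "x \<in> ?S") (simp_all add: not_le)
  qed
  moreover have "card (?S - ?B) = n ^ k - k * ((n + 1) choose k)"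
    using card_Diff_subset[OF finite_subset[OF sub fin] sub] card cardB by simp
  moreover have "k * ((n + 1) choose k) \<le> n ^ k"
    using card_mono[OF fin sub] card cardB by simp
  ultimately show ?thesis
    using assms(1) by (simp add: measure_pmf_of_set[OF ne fin] card of_nat_diff diff_divide_distrib
      del: of_nat_mult of_nat_power)
qed

end
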